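(* There is a $10$-dimensional reflexive polytope that violates the half-strip condition $-d/2\leq\operatorname{Re}(z)\leq d/2-1$ (with $d=10$) on the roots $z\in\mathbb{C}$ of its Ehrhart polynomial. Explicitly, let $e_1,\ldots,e_{10}$ be the standard basis of $\mathbb{Z}^{10}$ and let $$P=\operatorname{conv}\{e_1,\ldots,e_9,\ (1,2,0,1,2,0,1,1,2,3),\ (-4,-5,-2,-3,-4,-1,-2,-2,-3,-3)\}.$$ Then $P$ is a $10$-dimensional reflexive simplex with $\delta$-vector $(1,1,1,1,9,28,9,1,1,1,1)$, and its Ehrhart polynomial $L_P$ has a root $\alpha\in\mathbb{C}$ with $\operatorname{Re}(\alpha)<-5$ and a root $\beta\in\mathbb{C}$ with $\operatorname{Re}(\beta)>4$.
   Context: A $d$-dimensional lattice polytope is a full-dimensional convex polytope $P\subset\mathbb{Z}^d\otimes_{\mathbb{Z}}\mathbb{Q}$ with vertices in $\mathbb{Z}^d$. It is reflexive if its dual $P^*:=\{u\in\mathbb{Z}^d\otimes_{\mathbb{Z}}\mathbb{Q}\mid\langle u,v\rangle\geq -1\text{ for all }v\in P\}$ is also a lattice polytope. The Ehrhart polynomial $L_P$ is the degree-$d$ polynomial with $L_P(m)=|mP\cap\mathbb{Z}^d|$ for all integers $m\geq 0$, regarded as a polynomial over $\mathbb{C}$. The $\delta$-vector (or $h^*$-vector) $(\delta_0,\ldots,\delta_d)$ of $P$ is defined by $\sum_{m\geq 0}L_P(m)t^m=\frac{\delta_0+\delta_1t+\cdots+\delta_dt^d}{(1-t)^{d+1}}$.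 *)

theory Defs
  imports "HOL-Analysis.Analysis" "HOL-Computational_Algebra.Formal_Power_Series"
begin

text \<open>Polytopes live in \<open>\<int>\<^sup>d \<otimes> \<real>\<close> rather than \<open>\<int>\<^sup>d \<otimes> \<rat>\<close>, since the convexity
  library is about real vector spaces. For a lattice polytope the vertices, the lattice points of
  its dilates and the vertices of its dual are the same over both fields.\<close>

definition lattice_points :: "(real^'n) set" where
  "lattice_points = {x. \<forall>i. x $ i \<in> \<int>}"

definition lattice_polytope :: "(real^'n) set \<Rightarrow> bool" where
  "lattice_polytope P \<longleftrightarrow>
     polytope P \<and> aff_dim P = int CARD('n) \<and> {v. v extreme_point_of P} \<subseteq> lattice_points"

definition dual_polytope :: "(real^'n) set \<Rightarrow> (real^'n) set" where
  "dual_polytope P = {u. \<forall>v\<in>P. u \<bullet> v \<ge> -1}"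

definition reflexive_polytope :: "(real^'n) set \<Rightarrow> bool" where
  "reflexive_polytope P \<longleftrightarrow> lattice_polytope P \<and> lattice_polytope (dual_polytope P)"

definition is_ehrhart_polynomial :: "(real^'n) set \<Rightarrow> complex poly \<Rightarrow> bool" where
  "is_ehrhart_polynomial P L \<longleftrightarrow>
     degree L = CARD('n) \<and>
     (\<forall>m::nat. poly L (of_nat m) = of_nat (card ((\<lambda>x. real m *\<^sub>R x) ` P \<inter> lattice_points)))"

lemma is_ehrhart_polynomial_unique:
  assumes "is_ehrhart_polynomial P L" "is_ehrhart_polynomial P L'"
  shows "L = L'"
proof (rule ccontr)
  assume "L \<noteq> L'"
  then have "finite {x. poly (L - L') x = 0}"
    by (intro poly_roots_finite) simp
  moreover have "range (of_nat :: nat \<Rightarrow> complex) \<subseteq> {x. poly (L - L') x = 0}"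
    using assms by (auto simp: is_ehrhart_polynomial_def)
  ultimately show False
    by (meson finite_subset infinite_UNIV_char_0 finite_imageD inj_of_nat)
qed

definition ehrhart_polynomial :: "(real^'n) set \<Rightarrow> complex poly" where
  "ehrhart_polynomial P = (THE L. is_ehrhart_polynomial P L)"

lemma ehrhart_polynomial_eqI: "is_ehrhart_polynomial P L \<Longrightarrow> ehrhart_polynomial P = L"
  unfolding ehrhart_polynomial_def by (blast intro: is_ehrhart_polynomial_unique)

definition is_delta_vector :: "(real^'n) set \<Rightarrow> int list \<Rightarrow> bool" where
  "is_delta_vector P \<delta> \<longleftrightarrow>
     length \<delta> = CARD('n) + 1 \<and>
     Abs_fps (\<lambda>m. poly (ehrhart_polynomial P) (of_nat m)) =
       (\<Sum>i\<le>CARD('n). fps_const (of_int (\<delta> ! i)) * fps_X ^ i) / (1 - fps_X) ^ (CARD('n) + 1)"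

definition half_strip_condition :: "(real^'n) set \<Rightarrow> bool" where
  "half_strip_condition P \<longleftrightarrow>
     (\<forall>z. poly (ehrhart_polynomial P) z = 0 \<longrightarrow>
        - (real CARD('n) / 2) \<le> Re z \<and> Re z \<le> real CARD('n) / 2 - 1)"

end

(* The eleven vertices satisfy one affine relation with weights w = (3,3,2,2,2,1,1,1,1,1,1) of sum 18,
   and the vectors u_i with <u_i, v_j> = -1 for i \<noteq> j and <u_i, v_i> = 18 / w_i - 1 are
   integral; they are the vertices of the dual simplex. Splitting the barycentric coefficients of a
   lattice point of mP into integral and fractional parts counts these points as the sum over the
   fundamental parallelepiped of (m + 10 - height) choose 10. The parallelepiped consists of 54 points
   (beta_9, beta_10) = (l/18, j/18) with l congruent to j
   modulo 6, and their heights give the delta-vector.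
   By the symmetry z -> -1 - z the Ehrhart polynomial is a quintic in z (z + 1). The value of the
   quintic at a rational approximation y_0 of one of its roots is so small that some root lies within
   3/2 of y_0, and every y that close has a square root of 1 + 4 y with real part above 9. *)
theory Submission
  imports Defs "HOL-Library.Multiset" "HOL-Computational_Algebra.Fundamental_Theorem_Algebra"
begin

section \<open>Lattice points in dilated simplices\<close>

text \<open>Stars and bars: \<open>n\<close> is the multiplicity function of a multiset of size
  \<open>k\<close> over \<open>I\<close>. For empty \<open>I\<close> and \<open>k = 0\<close> the
  truncated \<open>card I + k - 1\<close> is \<open>0\<close>, which gives the correct count
  1.\<close>

lemma card_PiE_sum_eq:
  assumes "finite I"
  shows "card {n \<in> I \<rightarrow>\<^sub>E (UNIV :: nat set). sum n I = k} = (card I + k - 1) choose k"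
proof -
  have "bij_betw (\<lambda>M. restrict (count M) I) (multisets_of_size I k)
          {n \<in> I \<rightarrow>\<^sub>E (UNIV :: nat set). sum n I = k}"
  proof (rule bij_betwI[where g = "\<lambda>n. \<Sum>i\<in>I. replicate_mset (n i) i"])
    show "(\<lambda>M. restrict (count M) I) \<in> multisets_of_size I k \<rightarrow>
        {n \<in> I \<rightarrow>\<^sub>E (UNIV :: nat set). sum n I = k}"
    proof
      fix M assume M: "M \<in> multisets_of_size I k"
      have "sum (count M) I = size M"
        using M assms unfolding multisets_of_size_def size_multiset_overloaded_eq
        by (intro sum.mono_neutral_right) (auto simp: not_in_iff)
      then show "restrict (count M) I \<in> {n \<in> I \<rightarrow>\<^sub>E (UNIV :: nat set). sum n I = k}"
        using M by (simp add: multisets_of_size_def)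
    qed
    show "(\<lambda>n. \<Sum>i\<in>I. replicate_mset (n i) i) \<in>
        {n \<in> I \<rightarrow>\<^sub>E (UNIV :: nat set). sum n I = k} \<rightarrow> multisets_of_size I k"
      using assms by (auto simp: multisets_of_size_def set_mset_sum size_multiset_sum split: if_splits)
    show "(\<Sum>i\<in>I. replicate_mset (restrict (count M) I i) i) = M"
      if "M \<in> multisets_of_size I k" for M
      using that assms
      by (auto simp: multiset_eq_iff count_sum multisets_of_size_def sum.delta not_in_iff
            cong: if_cong)
    show "restrict (count (\<Sum>i\<in>I. replicate_mset (n i) i)) I = n"
      if "n \<in> {n \<in> I \<rightarrow>\<^sub>E (UNIV :: nat set). sum n I = k}" for n
      using that assms
      by (auto simp: fun_eq_iff count_sum PiE_def extensional_def restrict_def cong: if_cong)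
  qed
  then show ?thesis
    using card_multisets_of_size[OF assms] by (simp add: bij_betw_same_card[symmetric])
qed

text \<open>This is linear independence of the lifted vectors \<open>(v i, 1)\<close>. Indexing by
  \<open>I\<close> attaches coefficients to indices instead of points; for finite \<open>I\<close>,
  injectivity of \<open>v\<close> follows.\<close>

definition affine_independent_family :: "'i set \<Rightarrow> ('i \<Rightarrow> 'a::real_vector) \<Rightarrow> bool" where
  "affine_independent_family I v \<longleftrightarrow>
     (\<forall>c. sum c I = 0 \<longrightarrow> (\<Sum>i\<in>I. c i *\<^sub>R v i) = 0 \<longrightarrow> (\<forall>i\<in>I. c i = 0))"

lemma affine_independent_familyD:
  assumes "affine_independent_family I v"
    and "sum c I = sum c' I" and "(\<Sum>i\<in>I. c i *\<^sub>R v i) = (\<Sum>i\<in>I. c' i *\<^sub>R v i)" and "i \<in> I"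
  shows "c i = c' i"
proof -
  have "sum (\<lambda>i. c i - c' i) I = 0" "(\<Sum>i\<in>I. (c i - c' i) *\<^sub>R v i) = 0"
    using assms by (simp_all add: sum_subtractf scaleR_left_diff_distrib)
  then have "\<forall>i\<in>I. c i - c' i = 0"
    using assms(1)[unfolded affine_independent_family_def, THEN spec[of _ "\<lambda>i. c i - c' i"]]
    by blast
  then show ?thesis using assms(4) by simp
qed

text \<open>If \<open>v i = v j\<close>, the indicators of \<open>i\<close> and \<open>j\<close> are
  coefficient families with the same sum and the same combination.\<close>

lemma affine_independent_family_inj_on:
  assumes "finite I" "affine_independent_family I v"
  shows "inj_on v I"
proof (rule inj_onI, rule ccontr)
  fix i j assume ij: "i \<in> I" "j \<in> I" "v i = v j" "i \<noteq> j"
  have "of_bool (i = i) = (of_bool (i = j) :: real)"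
    using assms ij
    by (intro affine_independent_familyD[of I v "\<lambda>k. of_bool (k = i)" "\<lambda>k. of_bool (k = j)" i])
       (auto simp: of_bool_def if_distrib[of "\<lambda>c. c *\<^sub>R _"] cong: if_cong)
  then show False using ij by simp
qed

lemma affine_independent_family_image:
  assumes "finite I" "affine_independent_family I v"
  shows "\<not> affine_dependent (v ` I)"
proof
  assume "affine_dependent (v ` I)"
  then obtain c x where c: "sum c (v ` I) = 0" "(\<Sum>x\<in>v ` I. c x *\<^sub>R x) = 0"
    and x: "x \<in> v ` I" "c x \<noteq> 0"
    using assms(1) by (subst (asm) affine_dependent_explicit_finite) auto
  have "sum (\<lambda>i. c (v i)) I = sum (\<lambda>_. 0) I"
    "(\<Sum>i\<in>I. c (v i) *\<^sub>R v i) = (\<Sum>i\<in>I. 0 *\<^sub>R v i)"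
    using c affine_independent_family_inj_on[OF assms] by (simp_all add: sum.reindex)
  then have "\<forall>i\<in>I. c (v i) = 0"
    using affine_independent_familyD[OF assms(2)] by blast
  then show False using x by auto
qed

lemma simplex_convex_hull_family:
  assumes "finite I" "affine_independent_family I v"
  shows "(int (card I) - 1) simplex (convex hull (v ` I))"
  using assms
  by (intro simplex_convex_hull)
     (simp add: affine_independent_family_image card_image affine_independent_family_inj_on)

lemma aff_dim_convex_hull_family:
  fixes v :: "'i \<Rightarrow> 'a::euclidean_space"
  assumes "finite I" "affine_independent_family I v"
  shows "aff_dim (convex hull (v ` I)) = int (card I) - 1"
  using aff_dim_affine_independent[OF affine_independent_family_image[OF assms]]
    card_image[OF affine_independent_family_inj_on[OF assms]]
  by (simp add: aff_dim_convex_hull)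

lemma lattice_polytope_simplex:
  fixes v :: "'i \<Rightarrow> real^'n"
  assumes "finite I" "affine_independent_family I v" "card I = CARD('n) + 1"
    and "\<And>i. i \<in> I \<Longrightarrow> v i \<in> lattice_points"
  shows "lattice_polytope (convex hull (v ` I))"
  unfolding lattice_polytope_def
  using assms simplex_imp_polytope[OF simplex_convex_hull_family[OF assms(1,2)]]
  by (auto simp: aff_dim_convex_hull_family dest: extreme_point_of_convex_hull)

section \<open>Convex hulls and their dilates in barycentric coefficients\<close>

lemma convex_hull_image_eq:
  assumes "finite I" "inj_on v I"
  shows "convex hull (v ` I) = {\<Sum>i\<in>I. c i *\<^sub>R v i | c. (\<forall>i\<in>I. 0 \<le> c i) \<and> sum c I = 1}"
proof (intro equalityI subsetI)
  fix x assume "x \<in> convex hull (v ` I)"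
  then obtain c where "\<forall>x\<in>v ` I. 0 \<le> c x" "sum c (v ` I) = 1" "(\<Sum>x\<in>v ` I. c x *\<^sub>R x) = x"
    using assms by (auto simp: convex_hull_finite)
  then show "x \<in> {\<Sum>i\<in>I. c i *\<^sub>R v i | c. (\<forall>i\<in>I. 0 \<le> c i) \<and> sum c I = 1}"
    using assms by (auto simp: sum.reindex intro!: exI[of _ "c \<circ> v"])
next
  fix x assume "x \<in> {\<Sum>i\<in>I. c i *\<^sub>R v i | c. (\<forall>i\<in>I. 0 \<le> c i) \<and> sum c I = 1}"
  then obtain c where c: "x = (\<Sum>i\<in>I. c i *\<^sub>R v i)" "\<forall>i\<in>I. 0 \<le> c i" "sum c I = 1"
    by auto
  show "x \<in> convex hull (v ` I)"
    unfolding c(1) using assms(1) c by (intro convex_sum) (auto simp: hull_inc)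
qed

lemma dilate_convex_hull_image_eq:
  assumes "finite I" "inj_on v I" "I \<noteq> {}"
  shows "(\<lambda>x. real m *\<^sub>R x) ` (convex hull (v ` I)) =
    {\<Sum>i\<in>I. c i *\<^sub>R v i | c. (\<forall>i\<in>I. 0 \<le> c i) \<and> sum c I = real m}"
    (is "?L = ?R")
proof (intro equalityI subsetI)
  fix x assume "x \<in> ?L"
  then obtain c where "x = real m *\<^sub>R (\<Sum>i\<in>I. c i *\<^sub>R v i)" "\<forall>i\<in>I. 0 \<le> c i" "sum c I = 1"
    unfolding convex_hull_image_eq[OF assms(1,2)] by auto
  then show "x \<in> ?R"
    by (auto simp: scaleR_sum_right sum_distrib_left[symmetric] intro!: exI[of _ "\<lambda>i. real m * c i"])
next
  fix x assume "x \<in> ?R"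
  then obtain c where c: "x = (\<Sum>i\<in>I. c i *\<^sub>R v i)" "\<forall>i\<in>I. 0 \<le> c i" "sum c I = real m"
    by auto
  show "x \<in> ?L"
  \<comment> \<open>Dividing the coefficients by \<open>m\<close> fails for \<open>m = 0\<close>;
    there both sides are \<open>{0}\<close>, as \<open>I\<close> is nonempty.\<close>
  proof (cases "m = 0")
    case True
    then have "\<forall>i\<in>I. c i = 0"
      using c assms(1) by (simp add: sum_nonneg_eq_0_iff)
    then have "x = 0" using c by simp
    then show ?thesis using True assms(3) by (auto simp: image_iff)
  next
    case False
    have "(\<Sum>i\<in>I. (c i / real m) *\<^sub>R v i) \<in> convex hull (v ` I)"
      using False c assms by (intro convex_sum) (auto simp: sum_divide_distrib[symmetric] hull_inc)
    moreover have "x = real m *\<^sub>R (\<Sum>i\<in>I. (c i / real m) *\<^sub>R v i)"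
      using False c by (simp add: scaleR_sum_right)
    ultimately show ?thesis by blast
  qed
qed

section \<open>Counting through the fundamental parallelepiped\<close>

lemma lattice_points_add: "x \<in> lattice_points \<Longrightarrow> y \<in> lattice_points \<Longrightarrow> x + y \<in> lattice_points"
  by (simp add: lattice_points_def)

lemma lattice_points_diff: "x \<in> lattice_points \<Longrightarrow> y \<in> lattice_points \<Longrightarrow> x - y \<in> lattice_points"
  by (simp add: lattice_points_def)

lemma lattice_points_nat_combination:
  "(\<And>i. i \<in> I \<Longrightarrow> v i \<in> lattice_points) \<Longrightarrow> (\<Sum>i\<in>I. real (n i) *\<^sub>R v i) \<in> lattice_points"
  by (auto simp: lattice_points_def intro!: Ints_sum Ints_mult)

text \<open>The points of the half-open fundamental parallelepiped of the cone over the simplex, given by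
  their coefficients; the height of a point is the sum of its coefficients.\<close>

definition lattice_box :: "'i set \<Rightarrow> ('i \<Rightarrow> real^'n) \<Rightarrow> ('i \<Rightarrow> real) set" where
  "lattice_box I v = {\<beta> \<in> I \<rightarrow>\<^sub>E {0..<1}. sum \<beta> I \<in> \<int> \<and> (\<Sum>i\<in>I. \<beta> i *\<^sub>R v i) \<in> lattice_points}"

text \<open>The coefficients of a lattice point of the dilate are unique. Their fractional parts
  form a point \<open>\<beta>\<close> of the box, their floors a family of naturals whose sum is
  \<open>m\<close> minus the height of \<open>\<beta>\<close>; stars and bars counts such
  families.\<close>

theorem card_lattice_points_dilate:
  fixes v :: "'i \<Rightarrow> real^'n"
  assumes I: "finite I" "card I = Suc d" and indep: "affine_independent_family I v"
    and lat: "\<And>i. i \<in> I \<Longrightarrow> v i \<in> lattice_points" and fin: "finite (lattice_box I v)"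
  shows "card ((\<lambda>x. real m *\<^sub>R x) ` (convex hull (v ` I)) \<inter> lattice_points) =
    (\<Sum>\<beta>\<in>lattice_box I v. (m + d - nat \<lfloor>sum \<beta> I\<rfloor>) choose d)"
proof -
  define h where "h \<beta> = nat \<lfloor>sum \<beta> I\<rfloor>" for \<beta> :: "'i \<Rightarrow> real"
  define N where "N \<beta> = {n \<in> I \<rightarrow>\<^sub>E (UNIV :: nat set). sum n I + h \<beta> = m}" for \<beta>
  define F where "F = (\<lambda>(\<beta>, n). \<Sum>i\<in>I. (\<beta> i + real (n i)) *\<^sub>R v i)"
  let ?A = "(\<lambda>x. real m *\<^sub>R x) ` (convex hull (v ` I)) \<inter> lattice_points"
  have ne: "I \<noteq> {}" using I by auto
  note dil = dilate_convex_hull_image_eq[OF I(1) affine_independent_family_inj_on[OF I(1) indep] ne]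
  have boxD: "\<beta> \<in> I \<rightarrow>\<^sub>E {0..<1}" "real (h \<beta>) = sum \<beta> I"
    "(\<Sum>i\<in>I. \<beta> i *\<^sub>R v i) \<in> lattice_points" "h \<beta> \<le> d" if "\<beta> \<in> lattice_box I v" for \<beta>
  proof -
    show b: "\<beta> \<in> I \<rightarrow>\<^sub>E {0..<1}" and "(\<Sum>i\<in>I. \<beta> i *\<^sub>R v i) \<in> lattice_points"
      using that by (auto simp: lattice_box_def)
    have "0 \<le> sum \<beta> I" using b by (intro sum_nonneg) auto
    then show h: "real (h \<beta>) = sum \<beta> I"
      using that by (auto simp: lattice_box_def h_def elim!: Ints_cases)
    \<comment> \<open>Since \<open>d + 1\<close> coefficients below \<open>1\<close> have an
      integral sum, the height is at most \<open>d\<close>, so \<open>m + d - h \<beta>\<close> is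
      not truncated.\<close>
    have "sum \<beta> I < sum (\<lambda>_. 1) I"
      using b I ne by (intro sum_strict_mono) auto
    then show "h \<beta> \<le> d" using h I by simp
  qed
  have cardN: "card (N \<beta>) = (m + d - h \<beta>) choose d" if "\<beta> \<in> lattice_box I v" for \<beta>
  proof (cases "h \<beta> \<le> m")
    case True
    then have "N \<beta> = {n \<in> I \<rightarrow>\<^sub>E (UNIV :: nat set). sum n I = m - h \<beta>}"
      by (auto simp: N_def)
    then show ?thesis
      using True I card_PiE_sum_eq[OF I(1), of "m - h \<beta>"] binomial_symmetric[of d "m + d - h \<beta>"]
      by (simp add: algebra_simps)
  next
    \<comment> \<open>No family exists here, and the binomial vanishes as well:
      \<open>m < h \<beta> \<le> d\<close> gives \<open>m + d - h \<beta> < d\<close>.\<close>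
    case False
    then have "N \<beta> = {}" by (auto simp: N_def)
    then show ?thesis using False boxD(4)[OF that] by (simp add: binomial_eq_0)
  qed
  have finN: "finite (N \<beta>)" if "\<beta> \<in> lattice_box I v" for \<beta>
  proof (rule finite_subset)
    show "N \<beta> \<subseteq> I \<rightarrow>\<^sub>E {..m}"
    proof
      fix n assume "n \<in> N \<beta>"
      then have n: "n \<in> extensional I" "sum n I \<le> m" by (auto simp: N_def PiE_def)
      have "n i \<le> m" if "i \<in> I" for i
        using member_le_sum[of i I n] that I(1) n(2) by linarith
      then show "n \<in> I \<rightarrow>\<^sub>E {..m}" using n(1) by (auto simp: PiE_def)
    qed
    show "finite (I \<rightarrow>\<^sub>E {..m})"
      using I(1) by (intro finite_PiE) auto
  qed
  have sumF: "(\<Sum>i\<in>I. \<beta> i + real (n i)) = real m" if "\<beta> \<in> lattice_box I v" "n \<in> N \<beta>" for \<beta> n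
    using that boxD(2)[of \<beta>] by (auto simp: N_def sum.distrib)
  have "bij_betw F (Sigma (lattice_box I v) N) ?A"
  proof (rule bij_betw_imageI)
    show "inj_on F (Sigma (lattice_box I v) N)"
    proof (rule inj_onI, clarify)
      fix \<beta> n \<beta>' n'
      assume b: "\<beta> \<in> lattice_box I v" "\<beta>' \<in> lattice_box I v" and n: "n \<in> N \<beta>" "n' \<in> N \<beta>'"
        and eq: "F (\<beta>, n) = F (\<beta>', n')"
      have *: "\<beta> i = \<beta>' i \<and> n i = n' i" if "i \<in> I" for i
      proof -
        have e: "\<beta> i + real (n i) = \<beta>' i + real (n' i)"
          using indep eq sumF[OF b(1) n(1)] sumF[OF b(2) n(2)] that
          by (intro affine_independent_familyD[where c = "\<lambda>i. \<beta> i + real (n i)"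
                and c' = "\<lambda>i. \<beta>' i + real (n' i)"]) (auto simp: F_def)
        have "0 \<le> \<beta> i" "\<beta> i < 1" "0 \<le> \<beta>' i" "\<beta>' i < 1"
          using boxD(1)[OF b(1)] boxD(1)[OF b(2)] that by auto
        \<comment> \<open>Membership in \<open>[0, 1)\<close> recovers \<open>\<beta> i\<close> as a
          fractional part, and then \<open>n i\<close> as the difference.\<close>
        then have "frac (\<beta> i + real (n i)) = \<beta> i" "frac (\<beta>' i + real (n' i)) = \<beta>' i"
          by (subst frac_unique_iff; simp)+
        then show ?thesis using e by simp
      qed
      show "\<beta> = \<beta>' \<and> n = n'"
        using * boxD(1)[OF b(1)] boxD(1)[OF b(2)] n
        by (intro conjI; intro PiE_ext[of _ I "\<lambda>_. UNIV"]) (auto simp: N_def PiE_def)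
    qed
    show "F ` Sigma (lattice_box I v) N = ?A"
    proof (intro equalityI subsetI)
      fix x assume "x \<in> F ` Sigma (lattice_box I v) N"
      then obtain \<beta> n where b: "\<beta> \<in> lattice_box I v" "n \<in> N \<beta>" "x = F (\<beta>, n)" by auto
      have "x = (\<Sum>i\<in>I. \<beta> i *\<^sub>R v i) + (\<Sum>i\<in>I. real (n i) *\<^sub>R v i)"
        using b by (simp add: F_def scaleR_left_distrib sum.distrib)
      then have "x \<in> lattice_points"
        using boxD(3)[OF b(1)] lattice_points_nat_combination[of I v n] lat
        by (auto intro: lattice_points_add)
      moreover have "\<forall>i\<in>I. 0 \<le> \<beta> i + real (n i)"
        using boxD(1)[OF b(1)] by (auto intro!: add_nonneg_nonneg)
      ultimately show "x \<in> ?A"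
        using sumF[OF b(1,2)] b(3) unfolding dil
        by (auto simp: F_def intro!: exI[of _ "\<lambda>i. \<beta> i + real (n i)"])
    next
      fix x assume x: "x \<in> ?A"
      then obtain c where c: "x = (\<Sum>i\<in>I. c i *\<^sub>R v i)" "\<forall>i\<in>I. 0 \<le> c i" "sum c I = real m"
        unfolding dil by auto
      define \<beta> where "\<beta> = restrict (\<lambda>i. frac (c i)) I"
      define n where "n = restrict (\<lambda>i. nat \<lfloor>c i\<rfloor>) I"
      have cs: "c i = \<beta> i + real (n i)" if "i \<in> I" for i
        using that c by (simp add: \<beta>_def n_def frac_def)
      have 1: "sum \<beta> I = real m - real (sum n I)"
        using c(3) cs by (simp add: sum.distrib cong: sum.cong)
      have xs: "x = (\<Sum>i\<in>I. \<beta> i *\<^sub>R v i) + (\<Sum>i\<in>I. real (n i) *\<^sub>R v i)"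
        unfolding c(1) sum.distrib[symmetric] scaleR_left_distrib[symmetric]
        by (intro sum.cong) (auto simp: cs)
      then have 2: "(\<Sum>i\<in>I. \<beta> i *\<^sub>R v i) = x - (\<Sum>i\<in>I. real (n i) *\<^sub>R v i)"
        by simp
      have "\<beta> \<in> I \<rightarrow>\<^sub>E {0..<1}"
        by (auto simp: \<beta>_def frac_lt_1)
      moreover have "sum \<beta> I \<in> \<int>"
        unfolding 1 by (simp del: of_nat_sum)
      moreover have "(\<Sum>i\<in>I. \<beta> i *\<^sub>R v i) \<in> lattice_points"
        unfolding 2 using x lattice_points_nat_combination[of I v n] lat
        by (intro lattice_points_diff) auto
      ultimately have b: "\<beta> \<in> lattice_box I v"
        by (simp add: lattice_box_def)
      have "n \<in> N \<beta>"
      proof -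
        have "sum n I + h \<beta> = m"
          using boxD(2)[OF b] unfolding 1 by linarith
        then show ?thesis by (auto simp: N_def n_def)
      qed
      moreover have "x = F (\<beta>, n)"
        unfolding F_def c(1) by (auto intro!: sum.cong simp: cs)
      ultimately show "x \<in> F ` Sigma (lattice_box I v) N" using b by auto
    qed
  qed
  then have "card ?A = card (Sigma (lattice_box I v) N)"
    by (simp add: bij_betw_same_card)
  also have "\<dots> = (\<Sum>\<beta>\<in>lattice_box I v. card (N \<beta>))"
    using fin finN by (simp add: card_SigmaI)
  finally show ?thesis using cardN by (simp add: h_def)
qed

section \<open>Dual simplices, generating functions and roots\<close>

text \<open>Pairing a combination with \<open>u i\<close> gives \<open>c i * q i - sum c I\<close>,
  so a vanishing combination with \<open>sum c I = 0\<close> has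
  \<open>c i * q i = 0\<close>.\<close>

lemma affine_independent_family_if_dual:
  fixes u v :: "'i \<Rightarrow> 'a::real_inner"
  assumes "finite I" and "\<And>i. i \<in> I \<Longrightarrow> q i \<noteq> 0"
    and uv: "\<And>i j. i \<in> I \<Longrightarrow> j \<in> I \<Longrightarrow> u i \<bullet> v j = (if i = j then q i else 0) - 1"
  shows "affine_independent_family I v"
  unfolding affine_independent_family_def
proof (intro allI impI ballI)
  fix c i assume c: "sum c I = 0" "(\<Sum>j\<in>I. c j *\<^sub>R v j) = 0" and i: "i \<in> I"
  have "0 = u i \<bullet> (\<Sum>j\<in>I. c j *\<^sub>R v j)" using c by simp
  also have "\<dots> = (\<Sum>j\<in>I. (if i = j then c j * q i else 0) - c j)"
    unfolding inner_sum_right using i by (intro sum.cong) (auto simp: uv algebra_simps)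
  also have "\<dots> = c i * q i"
    using assms(1) i c by (simp add: sum_subtractf)
  finally show "c i = 0" using assms(2)[OF i] by simp
qed

lemma dual_polytope_convex_hull:
  "dual_polytope (convex hull S) = {u. \<forall>x\<in>S. u \<bullet> x \<ge> -1}"
proof (intro equalityI subsetI)
  fix u assume u: "u \<in> {u. \<forall>x\<in>S. u \<bullet> x \<ge> -1}"
  have "convex hull S \<subseteq> {x. u \<bullet> x \<ge> -1}"
    using u by (intro hull_minimal) (auto simp: convex_halfspace_ge)
  then show "u \<in> dual_polytope (convex hull S)" by (auto simp: dual_polytope_def)
qed (auto simp: dual_polytope_def hull_inc)

text \<open>A full-dimensional simplex affinely spans the whole space, so the hyperplane orthogonal
  to \<open>x\<close> contains \<open>x\<close> itself.\<close>

lemma eq_0_if_orthogonal_to_simplex: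
  fixes v :: "'i \<Rightarrow> real^'n"
  assumes "finite I" "affine_independent_family I v" "card I = CARD('n) + 1"
    and x: "\<And>i. i \<in> I \<Longrightarrow> x \<bullet> v i = 0"
  shows "x = 0"
proof -
  have "aff_dim (v ` I) = DIM(real^'n)"
    using aff_dim_convex_hull_family[OF assms(1,2)] assms(3) by (simp add: aff_dim_convex_hull)
  then have "affine hull (v ` I) = UNIV"
    by (simp only: aff_dim_eq_full)
  moreover have "affine hull (v ` I) \<subseteq> {y. x \<bullet> y = 0}"
    using x by (intro hull_minimal) (auto simp: affine_hyperplane)
  ultimately have "x \<bullet> x = 0" by blast
  then show ?thesis by simp
qed

text \<open>The \<open>1 / q i\<close> are the barycentric coordinates of the origin. A point
  \<open>y\<close> of the dual is a convex combination of the \<open>u i\<close> whose coefficients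
  are its slacks \<open>y \<bullet> v i + 1\<close>, scaled by \<open>1 / q i\<close>.\<close>

lemma dual_polytope_simplex:
  fixes u v :: "'i \<Rightarrow> real^'n"
  assumes I: "finite I" "card I = CARD('n) + 1" and q: "\<And>i. i \<in> I \<Longrightarrow> q i > 0"
    and uv: "\<And>i j. i \<in> I \<Longrightarrow> j \<in> I \<Longrightarrow> u i \<bullet> v j = (if i = j then q i else 0) - 1"
    and q1: "(\<Sum>i\<in>I. 1 / q i) = 1" and q0: "(\<Sum>i\<in>I. (1 / q i) *\<^sub>R v i) = 0"
  shows "dual_polytope (convex hull (v ` I)) = convex hull (u ` I)"
proof (intro equalityI subsetI)
  fix y assume "y \<in> convex hull (u ` I)"
  moreover have "convex hull (u ` I) \<subseteq> {y. \<forall>x\<in>v ` I. y \<bullet> x \<ge> -1}"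
  proof (rule hull_minimal)
    show "u ` I \<subseteq> {y. \<forall>x\<in>v ` I. y \<bullet> x \<ge> -1}"
      using q by (auto simp: uv less_imp_le)
    have "{y. \<forall>x\<in>v ` I. y \<bullet> x \<ge> -1} = (\<Inter>x\<in>v ` I. {y. x \<bullet> y \<ge> -1})"
      by (auto simp: inner_commute)
    then show "convex {y. \<forall>x\<in>v ` I. y \<bullet> x \<ge> -1}"
      by (auto intro!: convex_INT convex_halfspace_ge)
  qed
  ultimately show "y \<in> dual_polytope (convex hull (v ` I))"
    unfolding dual_polytope_convex_hull by blast
next
  fix y assume "y \<in> dual_polytope (convex hull (v ` I))"
  then have y: "y \<bullet> v i \<ge> -1" if "i \<in> I" for i
    using that by (auto simp: dual_polytope_convex_hull)
  \<comment> \<open>A combination of the \<open>u i\<close> with coefficient sum 1 pairs with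
    \<open>v j\<close> to \<open>\<mu> j * q j - 1\<close>, which forces this choice. Nonnegativity
    is the dual inequality.\<close>
  define \<mu> where "\<mu> i = (y \<bullet> v i + 1) / q i" for i
  have "(\<Sum>i\<in>I. \<mu> i) = y \<bullet> (\<Sum>i\<in>I. (1 / q i) *\<^sub>R v i) + (\<Sum>i\<in>I. 1 / q i)"
    by (simp add: \<mu>_def inner_sum_right sum.distrib[symmetric] add_divide_distrib)
  then have \<mu>1: "(\<Sum>i\<in>I. \<mu> i) = 1" using q0 q1 by simp
  have indep: "affine_independent_family I v"
    using q by (intro affine_independent_family_if_dual[OF I(1) _ uv]) (auto simp: less_imp_neq[symmetric])
  have "((\<Sum>i\<in>I. \<mu> i *\<^sub>R u i) - y) \<bullet> v j = 0" if j: "j \<in> I" for j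
  proof -
    have "(\<Sum>i\<in>I. \<mu> i *\<^sub>R u i) \<bullet> v j = (\<Sum>i\<in>I. (if i = j then \<mu> i * q i else 0) - \<mu> i)"
      unfolding inner_sum_left using j by (intro sum.cong) (auto simp: uv algebra_simps)
    also have "\<dots> = y \<bullet> v j"
      using I j \<mu>1 q[OF j] by (simp add: sum_subtractf \<mu>_def)
    finally show ?thesis by (simp add: inner_diff_left)
  qed
  then have "(\<Sum>i\<in>I. \<mu> i *\<^sub>R u i) - y = 0"
    by (rule eq_0_if_orthogonal_to_simplex[OF I(1) indep I(2)])
  moreover have "(\<Sum>i\<in>I. \<mu> i *\<^sub>R u i) \<in> convex hull (u ` I)"
  proof (intro convex_sum)
    show "\<mu> i \<ge> 0" if "i \<in> I" for i
      using y[OF that] q[OF that] by (simp add: \<mu>_def)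
  qed (use I \<mu>1 in \<open>auto simp: hull_inc\<close>)
  ultimately show "y \<in> convex hull (u ` I)" by simp
qed

text \<open>The series \<open>1 / (1 - X) ^ (d + 1)\<close> has coefficients
  \<open>(d + k) choose k\<close>, and \<open>X ^ k\<close> shifts them. Below the shift,
  \<open>m < k \<le> d\<close> makes the binomial on the left vanish.\<close>

lemma fps_binomial_generating_function:
  fixes c :: "nat \<Rightarrow> 'a::field_char_0"
  shows "Abs_fps (\<lambda>m. \<Sum>k\<le>d. c k * of_nat ((m + d - k) choose d)) =
    (\<Sum>k\<le>d. fps_const (c k) * fps_X ^ k) / (1 - fps_X) ^ (d + 1)"
proof -
  have inv: "inverse ((1 - fps_X) ^ (d + 1)) = Abs_fps (\<lambda>k. of_nat ((d + k) choose k) :: 'a)"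
    using one_minus_const_fps_X_neg_power'[of "d + 1" "1 :: 'a"] by simp
  have "fps_nth ((\<Sum>k\<le>d. fps_const (c k) * fps_X ^ k) / (1 - fps_X) ^ (d + 1)) m =
      (\<Sum>k\<le>d. c k * of_nat ((m + d - k) choose d))" for m
  proof -
    have "fps_nth ((\<Sum>k\<le>d. fps_const (c k) * fps_X ^ k) / (1 - fps_X) ^ (d + 1)) m =
      (\<Sum>k\<le>d. c k * fps_nth (fps_X ^ k * inverse ((1 - fps_X) ^ (d + 1))) m)"
      by (simp add: fps_divide_unit sum_distrib_right fps_sum_nth mult.assoc del: power_Suc)
    also have "\<dots> = (\<Sum>k\<le>d. c k * of_nat ((m + d - k) choose d))"
    proof (rule sum.cong)
      fix k assume k: "k \<in> {..d}"
      show "c k * fps_nth (fps_X ^ k * inverse ((1 - fps_X) ^ (d + 1))) m = c k * of_nat ((m + d - k) choose d)"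
      proof (cases "m < k")
        case True
        then have "(m + d - k) choose d = 0" using k by (intro binomial_eq_0) auto
        then show ?thesis using True by (simp add: fps_X_power_mult_nth)
      next
        case False
        then have "d + (m - k) choose (m - k) = (m + d - k) choose d"
          using binomial_symmetric[of d "m + d - k"] by (simp add: algebra_simps)
        then show ?thesis using False unfolding inv by (simp add: fps_X_power_mult_nth)
      qed
    qed auto
    finally show ?thesis .
  qed
  then show ?thesis by (simp add: fps_eq_iff)
qed

text \<open>If all roots were at distance at least \<open>r\<close> from \<open>z\<close>, the
  factorization into linear factors would give
  \<open>norm (poly p z) \<ge> norm (lead_coeff p) * r ^ degree p\<close>.\<close>

lemma exists_root_near:
  fixes p :: "complex poly"
  assumes "degree p > 0" "0 \<le> r" "norm (poly p z) < norm (lead_coeff p) * r ^ degree p"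
  obtains w where "poly p w = 0" "norm (w - z) < r"
proof -
  obtain \<rho> where \<rho>: "smult (lead_coeff p) (\<Prod>i<degree p. [:-\<rho> i, 1:]) = p"
    by (rule complex_poly_decompose')
  have eval: "poly p w = lead_coeff p * (\<Prod>i<degree p. w - \<rho> i)" for w
    by (subst \<rho>[symmetric]) (simp add: poly_prod)
  have "\<exists>i<degree p. norm (\<rho> i - z) < r"
  proof (rule ccontr)
    assume "\<not> (\<exists>i<degree p. norm (\<rho> i - z) < r)"
    then have "r \<le> norm (z - \<rho> i)" if "i < degree p" for i
      using that by (metis norm_minus_commute not_less)
    then have "(\<Prod>i<degree p. r) \<le> (\<Prod>i<degree p. norm (z - \<rho> i))"
      using assms(2) by (intro prod_mono) auto
    then have "norm (lead_coeff p) * r ^ degree p \<le> norm (poly p z)"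
      unfolding eval by (auto simp: norm_mult prod_norm intro: mult_left_mono)
    then show False using assms(3) by simp
  qed
  then obtain i where "i < degree p" "norm (\<rho> i - z) < r" by blast
  moreover from this have "poly p (\<rho> i) = 0"
    unfolding eval by auto
  ultimately show ?thesis using that by blast
qed

section \<open>Reflexivity\<close>

text \<open>In the type \<open>10\<close> the numeral \<open>10\<close> equals \<open>0\<close>, so
  \<open>1, ..., 10\<close> lists every index once, in the order in which \<open>vector\<close>
  fills them.\<close>

lemma UNIV_10: "(UNIV :: 10 set) = {1, 2, 3, 4, 5, 6, 7, 8, 9, 10}"
  by (rule sym, rule card_subset_eq) simp_all

lemma sum_10: "sum f (UNIV :: 10 set) = f 1 + f 2 + f 3 + f 4 + f 5 + f 6 + f 7 + f 8 + f 9 + f 10"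
  unfolding UNIV_10 by (simp add: ac_simps)

lemma forall_10: "(\<forall>i :: 10. Q i) \<longleftrightarrow> Q 1 \<and> Q 2 \<and> Q 3 \<and> Q 4 \<and> Q 5 \<and> Q 6 \<and> Q 7 \<and> Q 8 \<and> Q 9 \<and> Q 10"
  using UNIV_10 by (metis UNIV_I empty_iff insert_iff)

lemma vector_10:
  fixes x1 :: "'a::zero"
  shows "(vector [x1,x2,x3,x4,x5,x6,x7,x8,x9,x10] :: 'a^10) $ 1 = x1"
    "(vector [x1,x2,x3,x4,x5,x6,x7,x8,x9,x10] :: 'a^10) $ 2 = x2"
    "(vector [x1,x2,x3,x4,x5,x6,x7,x8,x9,x10] :: 'a^10) $ 3 = x3"
    "(vector [x1,x2,x3,x4,x5,x6,x7,x8,x9,x10] :: 'a^10) $ 4 = x4"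
    "(vector [x1,x2,x3,x4,x5,x6,x7,x8,x9,x10] :: 'a^10) $ 5 = x5"
    "(vector [x1,x2,x3,x4,x5,x6,x7,x8,x9,x10] :: 'a^10) $ 6 = x6"
    "(vector [x1,x2,x3,x4,x5,x6,x7,x8,x9,x10] :: 'a^10) $ 7 = x7"
    "(vector [x1,x2,x3,x4,x5,x6,x7,x8,x9,x10] :: 'a^10) $ 8 = x8"
    "(vector [x1,x2,x3,x4,x5,x6,x7,x8,x9,x10] :: 'a^10) $ 9 = x9"
    "(vector [x1,x2,x3,x4,x5,x6,x7,x8,x9,x10] :: 'a^10) $ 10 = x10"
  by (simp_all add: vector_def)

section \<open>The simplex and the vertices of its dual\<close>

definition vertex :: "nat \<Rightarrow> real^10" where
  "vertex i = [axis 1 1, axis 2 1, axis 3 1, axis 4 1, axis 5 1, axis 6 1, axis 7 1, axis 8 1, axis 9 1,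
     vector [1, 2, 0, 1, 2, 0, 1, 1, 2, 3], vector [-4, -5, -2, -3, -4, -1, -2, -2, -3, -3]] ! i"

text \<open>The unit vectors force the first nine coordinates: \<open>-1\<close>, except
  \<open>pairing i - 1\<close> at the coordinate of \<open>vertex i\<close> for
  \<open>i < 9\<close>. The tenth then follows from the pairing with \<open>vertex 9\<close>, or
  with \<open>vertex 10\<close> when \<open>i = 9\<close>.\<close>

definition dual_vertex :: "nat \<Rightarrow> real^10" where
  "dual_vertex i = [
     vector [5, -1, -1, -1, -1, -1, -1, -1, -1, 1],
     vector [-1, 5, -1, -1, -1, -1, -1, -1, -1, -1],
     vector [-1, -1, 8, -1, -1, -1, -1, -1, -1, 3],
     vector [-1, -1, -1, 8, -1, -1, -1, -1, -1, 0],
     vector [-1, -1, -1, -1, 8, -1, -1, -1, -1, -3],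
     vector [-1, -1, -1, -1, -1, 17, -1, -1, -1, 3],
     vector [-1, -1, -1, -1, -1, -1, 17, -1, -1, -3],
     vector [-1, -1, -1, -1, -1, -1, -1, 17, -1, -3],
     vector [-1, -1, -1, -1, -1, -1, -1, -1, 17, -9],
     vector [-1, -1, -1, -1, -1, -1, -1, -1, -1, 9],
     vector [-1, -1, -1, -1, -1, -1, -1, -1, -1, 3]] ! i"

text \<open>\<open>pairing i\<close> is \<open>18 / w i\<close> for the weights \<open>w = (3, 3, 2, 2, 2, 1, 1, 1, 1, 1, 1)\<close>, so the
  barycentric coordinates of the origin are \<open>1 / pairing i\<close>.\<close>

definition pairing :: "nat \<Rightarrow> real" where
  "pairing i = [6, 6, 9, 9, 9, 18, 18, 18, 18, 18, 18] ! i"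

lemma forall_less_11: "(\<forall>i<11. Q i) \<longleftrightarrow> Q 0 \<and> Q 1 \<and> Q 2 \<and> Q 3 \<and> Q 4 \<and> Q 5 \<and> Q 6 \<and> Q 7 \<and> Q 8 \<and> Q 9 \<and> Q (10::nat)"
  by (simp add: eval_nat_numeral All_less_Suc conj_ac)

lemma sum_less_11: "(\<Sum>i<11. f i) = f 0 + f 1 + f 2 + f 3 + f 4 + f 5 + f 6 + f 7 + f 8 + f 9 + f (10::nat)"
  by (simp add: eval_nat_numeral)

lemma vertex_simps:
  "vertex 0 = axis 1 1" "vertex 1 = axis 2 1" "vertex 2 = axis 3 1" "vertex 3 = axis 4 1"
  "vertex 4 = axis 5 1" "vertex 5 = axis 6 1" "vertex 6 = axis 7 1" "vertex 7 = axis 8 1"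
  "vertex 8 = axis 9 1" "vertex 9 = vector [1, 2, 0, 1, 2, 0, 1, 1, 2, 3]"
  "vertex 10 = vector [-4, -5, -2, -3, -4, -1, -2, -2, -3, -3]"
  by (simp_all add: vertex_def)

lemma vertex_image:
  "vertex ` {..<11} =
    {axis 1 1, axis 2 1, axis 3 1, axis 4 1, axis 5 1, axis 6 1, axis 7 1, axis 8 1, axis 9 1,
     vector [1, 2, 0, 1, 2, 0, 1, 1, 2, 3], vector [-4, -5, -2, -3, -4, -1, -2, -2, -3, -3]}"
proof -
  have "{..<11} = {0, 1, 2, 3, 4, 5, 6, 7, 8, 9, 10 :: nat}"
    unfolding set_eq_iff by (simp; presburger)
  then show ?thesis by (simp only: image_insert image_empty vertex_simps)
qed

lemma dual_vertex_inner_vertex: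
  assumes "i < 11" "j < 11"
  shows "dual_vertex i \<bullet> vertex j = (if i = j then pairing i else 0) - 1"
proof -
  have "\<forall>i<11. \<forall>j<11. dual_vertex i \<bullet> vertex j = (if i = j then pairing i else 0) - 1"
    unfolding forall_less_11 vertex_simps
    by (simp add: dual_vertex_def pairing_def inner_axis vector_10 inner_vec_def[of "vector _"] sum_10)
  then show ?thesis using assms by blast
qed

lemma pairing_pos: "i < 11 \<Longrightarrow> pairing i > 0"
proof -
  have "\<forall>i<11. pairing i > 0" unfolding forall_less_11 by (simp add: pairing_def)
  then show "i < 11 \<Longrightarrow> pairing i > 0" by blast
qed

lemma vertex_in_lattice: "i < 11 \<Longrightarrow> vertex i \<in> lattice_points"
proof -
  have "\<forall>i<11. vertex i \<in> lattice_points"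
    unfolding forall_less_11 vertex_simps lattice_points_def
    by (simp add: forall_10 vector_10 axis_def)
  then show "i < 11 \<Longrightarrow> vertex i \<in> lattice_points" by blast
qed

lemma dual_vertex_in_lattice: "i < 11 \<Longrightarrow> dual_vertex i \<in> lattice_points"
proof -
  have "\<forall>i<11. dual_vertex i \<in> lattice_points"
    unfolding forall_less_11 lattice_points_def
    by (simp add: dual_vertex_def forall_10 vector_10)
  then show "i < 11 \<Longrightarrow> dual_vertex i \<in> lattice_points" by blast
qed

text \<open>Only the last two vertices have a nonzero tenth coordinate. The formula serves both the
  relation that places the origin in the simplex and the integrality conditions of the box.\<close>

lemma vertex_combination:
  defines "a \<equiv> [1, 2, 0, 1, 2, 0, 1, 1, 2]" and "b \<equiv> [-4, -5, -2, -3, -4, -1, -2, -2, -3]"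
  shows "(\<Sum>i<11. c i *\<^sub>R vertex i) =
    vector (map (\<lambda>i. c i + a ! i * c 9 + b ! i * c 10) [0, 1, 2, 3, 4, 5, 6, 7, 8] @ [3 * (c 9 - c 10)])"
  unfolding vec_eq_iff forall_10 sum_less_11 vertex_simps
  by (simp add: vector_10 axis_def a_def b_def)

lemma affine_independent_vertex: "affine_independent_family {..<11} vertex"
  using pairing_pos dual_vertex_inner_vertex
  by (intro affine_independent_family_if_dual[of _ pairing dual_vertex]) (auto simp: less_imp_neq[symmetric])

lemma affine_independent_dual_vertex: "affine_independent_family {..<11} dual_vertex"
  using pairing_pos dual_vertex_inner_vertex
  by (intro affine_independent_family_if_dual[of _ pairing vertex])
     (auto simp: less_imp_neq[symmetric] inner_commute[of "vertex _"])

lemma reflexive_polytope_vertex: "reflexive_polytope (convex hull (vertex ` {..<11}))"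
proof -
  have "(\<Sum>i<11. (1 / pairing i) *\<^sub>R vertex i) = 0"
    unfolding vertex_combination vec_eq_iff forall_10 by (simp add: vector_10 pairing_def)
  moreover have "(\<Sum>i<11. 1 / pairing i) = 1"
    unfolding sum_less_11 by (simp add: pairing_def)
  ultimately have "dual_polytope (convex hull (vertex ` {..<11})) = convex hull (dual_vertex ` {..<11})"
    using pairing_pos dual_vertex_inner_vertex by (intro dual_polytope_simplex[of _ pairing]) auto
  then show ?thesis
    unfolding reflexive_polytope_def
    using vertex_in_lattice dual_vertex_in_lattice affine_independent_vertex affine_independent_dual_vertex
    by (auto intro!: lattice_polytope_simplex)
qed

section \<open>The Ehrhart polynomial\<close>

text \<open>A point \<open>\<beta>\<close> of the parallelepiped is determined by \<open>\<beta> 9 = l / 18\<close> and \<open>\<beta> 10 = j / 18\<close>, since all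
  coordinates of \<open>\<Sum>i<11. \<beta> i *\<^sub>R vertex i\<close> are integral; \<open>residue l j i\<close> is then \<open>18 * \<beta> i\<close>.\<close>

definition residue :: "int \<Rightarrow> int \<Rightarrow> nat \<Rightarrow> int" where
  "residue l j i = ([-1, -2, 0, -1, -2, 0, -1, -1, -2, 1, 0] ! i * l +
                    [4, 5, 2, 3, 4, 1, 2, 2, 3, 0, 1] ! i * j) mod 18"

definition box_point :: "int \<times> int \<Rightarrow> nat \<Rightarrow> real" where
  "box_point = (\<lambda>(l, j). restrict (\<lambda>i. real_of_int (residue l j i) / 18) {..<11})"

text \<open>The congruence says that the tenth coordinate \<open>3 * (l - j) / 18\<close> is
  integral. A list lets the heights be evaluated.\<close>

definition box_index :: "(int \<times> int) list" where
  "box_index = [(l, j). l \<leftarrow> [0..17], j \<leftarrow> [0..17], (l - j) mod 6 = 0]"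

lemma set_box_index:
  "set box_index = {(l, j). 0 \<le> l \<and> l < 18 \<and> 0 \<le> j \<and> j < 18 \<and> (l - j) mod 6 = 0}"
  by (auto simp: box_index_def)

lemma mod_18_eqI:
  assumes "x = real_of_int (n + 18 * e) / 18" "0 \<le> x" "x < 1"
  shows "x = real_of_int (n mod 18) / 18"
proof -
  define k where "k = n + 18 * e"
  have "0 \<le> k" "k < 18"
    using assms unfolding k_def[symmetric] by simp_all
  then have "n mod 18 = k" unfolding k_def by presburger
  then show ?thesis using assms(1) unfolding k_def by simp
qed

lemma mod_18_eq: "real_of_int (n mod 18) / 18 = real_of_int n / 18 - real_of_int (n div 18)"
proof -
  have "real_of_int (n mod 18) = real_of_int n - 18 * real_of_int (n div 18)"
    by (subst minus_mult_div_eq_mod[symmetric]) simp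
  then show ?thesis by (simp add: diff_divide_distrib)
qed

lemma vector_in_lattice_iff:
  "(vector [x1,x2,x3,x4,x5,x6,x7,x8,x9,x10] :: real^10) \<in> lattice_points \<longleftrightarrow>
    x1 \<in> \<int> \<and> x2 \<in> \<int> \<and> x3 \<in> \<int> \<and> x4 \<in> \<int> \<and> x5 \<in> \<int> \<and>
    x6 \<in> \<int> \<and> x7 \<in> \<int> \<and> x8 \<in> \<int> \<and> x9 \<in> \<int> \<and> x10 \<in> \<int>"
  by (simp add: lattice_points_def forall_10 vector_10)

lemma box_vertex_iff:
  assumes "\<beta> \<in> {..<11} \<rightarrow>\<^sub>E {0..<1}"
  shows "\<beta> \<in> lattice_box {..<11} vertex \<longleftrightarrow>
    sum \<beta> {..<11} \<in> \<int> \<and>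
    (\<forall>i<9. \<beta> i + [1, 2, 0, 1, 2, 0, 1, 1, 2] ! i * \<beta> 9 + [-4, -5, -2, -3, -4, -1, -2, -2, -3] ! i * \<beta> 10 \<in> \<int>) \<and>
    3 * (\<beta> 9 - \<beta> 10) \<in> \<int>"
proof -
  have forall_less_9: "(\<forall>i<9. Q i) \<longleftrightarrow> Q 0 \<and> Q 1 \<and> Q 2 \<and> Q 3 \<and> Q 4 \<and> Q 5 \<and> Q 6 \<and> Q 7 \<and> Q (8::nat)" for Q
    by (simp add: eval_nat_numeral All_less_Suc conj_ac)
  show ?thesis
    by (simp only: lattice_box_def vertex_combination list.map append.simps vector_in_lattice_iff
        forall_less_9 conj_assoc mem_Collect_eq assms simp_thms)
qed

lemma box_vertex: "lattice_box {..<11} vertex = box_point ` set box_index"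
proof (intro equalityI subsetI)
  fix \<beta> assume \<beta>: "\<beta> \<in> lattice_box {..<11} vertex"
  then have pi: "\<beta> \<in> {..<11} \<rightarrow>\<^sub>E {0..<1}" by (simp add: lattice_box_def)
  have bd: "0 \<le> \<beta> i" "\<beta> i < 1" if "i < 11" for i
    using PiE_mem[OF pi, of i] that by simp_all
  define coord where "coord i = \<beta> i + [1, 2, 0, 1, 2, 0, 1, 1, 2] ! i * \<beta> 9 +
    [-4, -5, -2, -3, -4, -1, -2, -2, -3] ! i * \<beta> 10" for i
  have coord: "coord i \<in> \<int>" if "i < 9" for i
    using \<beta> that unfolding box_vertex_iff[OF pi] coord_def by blast
  have c10: "3 * (\<beta> 9 - \<beta> 10) \<in> \<int>" and s: "sum \<beta> {..<11} \<in> \<int>"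
    using \<beta> unfolding box_vertex_iff[OF pi] by blast+
  \<comment> \<open>Subtracting the nine coordinates from the height leaves
    \<open>27 * \<beta> 10 - 9 * \<beta> 9\<close>; adding
    \<open>9 * (\<beta> 9 - \<beta> 10)\<close> eliminates \<open>\<beta> 9\<close>.\<close>
  have "18 * \<beta> 10 = sum \<beta> {..<11} - (\<Sum>i<9. coord i) + 3 * (3 * (\<beta> 9 - \<beta> 10))"
    unfolding sum_less_11 coord_def by (simp add: eval_nat_numeral)
  also have "\<dots> \<in> \<int>"
  proof (intro Ints_add[OF Ints_diff[OF s]] Ints_mult[OF _ c10])
    show "(\<Sum>i<9. coord i) \<in> \<int>" using coord by (intro Ints_sum) auto
  qed simp
  finally obtain j where j: "18 * \<beta> 10 = real_of_int j" by (auto elim: Ints_cases)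
  obtain c where c: "3 * (\<beta> 9 - \<beta> 10) = real_of_int c" using c10 by (auto elim: Ints_cases)
  define l where "l = j + 6 * c"
  have l: "18 * \<beta> 9 = real_of_int l" using j c by (simp add: l_def)
  have lj: "(l, j) \<in> set box_index"
    using bd[of 9] bd[of 10] l j by (auto simp: set_box_index l_def)
  have "\<beta> i = real_of_int (residue l j i) / 18" if i: "i < 11" for i
  proof (cases "i < 9")
    case True
    then obtain e where "coord i = real_of_int e" using coord by (auto elim: Ints_cases)
    \<comment> \<open>Solving for \<open>\<beta> i\<close> fixes its numerator up to multiples of
      \<open>18\<close>, and \<open>0 \<le> \<beta> i < 1\<close> selects the residue.\<close>
    moreover have "\<forall>i<9. coord i = e \<longrightarrow> \<beta> i = real_of_int ([-1, -2, 0, -1, -2, 0, -1, -1, -2, 1, 0] ! i * l +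
                    [4, 5, 2, 3, 4, 1, 2, 2, 3, 0, 1] ! i * j + 18 * e) / 18"
      using j l unfolding coord_def by (simp add: eval_nat_numeral All_less_Suc)
    ultimately show ?thesis
      unfolding residue_def using bd[OF i] True by (intro mod_18_eqI) auto
  next
    case False
    then consider "i = 9" | "i = 10" using i by linarith
    then show ?thesis using lj j l by cases (auto simp: residue_def set_box_index)
  qed
  then have "\<beta> = box_point (l, j)"
    using pi by (auto simp: box_point_def fun_eq_iff PiE_def extensional_def)
  then show "\<beta> \<in> box_point ` set box_index" using lj by blast
next
  fix \<beta> assume "\<beta> \<in> box_point ` set box_index"
  then obtain l j where \<beta>: "\<beta> = box_point (l, j)" and lj: "(l, j) \<in> set box_index" by auto
  have bp: "\<beta> i = real_of_int (residue l j i) / 18" if "i < 11" for i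
    using that by (simp add: \<beta> box_point_def)
  have pi: "\<beta> \<in> {..<11} \<rightarrow>\<^sub>E {0..<1}"
    by (auto simp: \<beta> box_point_def residue_def)
  obtain c where c: "l = j + 6 * c"
  proof
    have "(l - j) mod 6 = 0" using lj by (simp add: set_box_index)
    then show "l = j + 6 * ((l - j) div 6)" by presburger
  qed
  have l: "\<beta> 9 = l / 18" and j: "\<beta> 10 = j / 18"
    using lj by (auto simp: bp residue_def set_box_index)
  define n where "n i = [-1, -2, 0, -1, -2, 0, -1, -1, -2, 1, 0] ! i * l +
                    [4, 5, 2, 3, 4, 1, 2, 2, 3, 0, 1] ! i * j" for i :: nat
  \<comment> \<open>The term \<open>n i / 18\<close> cancels the contribution of the last two
    vertices, so only the quotient removed by \<open>mod 18\<close> remains.\<close>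
  have "\<forall>i<9. \<beta> i + [1, 2, 0, 1, 2, 0, 1, 1, 2] ! i * \<beta> 9 +
      [-4, -5, -2, -3, -4, -1, -2, -2, -3] ! i * \<beta> 10 =
      - real_of_int (n i div 18)"
    unfolding l j n_def by (simp add: bp residue_def mod_18_eq eval_nat_numeral All_less_Suc field_simps)
  moreover have "3 * (\<beta> 9 - \<beta> 10) = real_of_int c"
    unfolding l j c by (simp add: add_divide_distrib)
  moreover have "sum \<beta> {..<11} = real_of_int (j - 3 * c) - (\<Sum>i<11. real_of_int (n i div 18))"
  proof -
    have "sum \<beta> {..<11} = (\<Sum>i<11. real_of_int (n i) / 18 - real_of_int (n i div 18))"
      by (intro sum.cong) (simp_all add: bp residue_def n_def mod_18_eq)
    also have "\<dots> = real_of_int (\<Sum>i<11. n i) / 18 - (\<Sum>i<11. real_of_int (n i div 18))"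
      by (simp add: sum_subtractf sum_divide_distrib)
    \<comment> \<open>The numerators add up to \<open>27 * j - 9 * l\<close>, a multiple of
      \<open>18\<close> because \<open>l = j + 6 * c\<close>.\<close>
    also have "(\<Sum>i<11. n i) = 18 * (j - 3 * c)"
      unfolding sum_less_11 n_def c by simp
    finally show ?thesis by simp
  qed
  ultimately show "\<beta> \<in> lattice_box {..<11} vertex"
    unfolding box_vertex_iff[OF pi] by (auto intro!: Ints_diff Ints_sum)
qed

lemma inj_on_box_point: "inj_on box_point (set box_index)"
proof (rule inj_onI, clarify)
  fix l j l' j'
  assume *: "(l, j) \<in> set box_index" "(l', j') \<in> set box_index" "box_point (l, j) = box_point (l', j')"
  show "l = l' \<and> j = j'"
    using *(1,2) fun_cong[OF *(3), of 9] fun_cong[OF *(3), of 10]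
    by (simp add: box_point_def residue_def set_box_index)
qed

text \<open>These are the heights of the 54 points of the box; the multiplicities of
  \<open>0, ..., 10\<close> among them form the delta-vector.\<close>

lemma heights_box_index:
  "map (\<lambda>(l, j). (\<Sum>i\<leftarrow>[0..<11]. residue l j i) div 18) box_index = [0, 4, 4, 1, 5, 5, 2, 5, 5, 3, 5, 5, 4, 5, 5, 5, 6, 6, 4, 4, 4, 5, 5, 5, 5, 6, 5, 5, 4, 5, 5, 5, 5, 6, 6, 6, 4, 4, 5, 5, 5, 6, 5, 5, 7, 5, 5, 8, 5, 5, 9, 6, 6, 10]"
  by code_simp

lemma distinct_box_index: "distinct box_index"
  by code_simp

text \<open>Points are grouped by height for an arbitrary \<open>f\<close>; taking the binomial
  coefficient as \<open>f\<close> yields the lattice point count.\<close>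

lemma sum_box_vertex:
  "(\<Sum>\<beta>\<in>lattice_box {..<11} vertex. f (nat \<lfloor>sum \<beta> {..<11}\<rfloor>)) =
    (\<Sum>k\<le>10. [1, 1, 1, 1, 9, 28, 9, 1, 1, 1, 1] ! k * (f k :: nat))"
proof -
  have "(\<Sum>\<beta>\<in>lattice_box {..<11} vertex. f (nat \<lfloor>sum \<beta> {..<11}\<rfloor>)) =
    (\<Sum>(l, j)\<in>set box_index. f (nat \<lfloor>sum (box_point (l, j)) {..<11}\<rfloor>))"
    unfolding box_vertex by (simp add: sum.reindex inj_on_box_point case_prod_unfold)
  also have "\<dots> = (\<Sum>(l, j)\<in>set box_index. f (nat ((\<Sum>i\<leftarrow>[0..<11]. residue l j i) div 18)))"
  proof (intro sum.cong refl, clarify)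
    fix l j
    have "sum (box_point (l, j)) {..<11} =
        real_of_int (\<Sum>i\<leftarrow>[0..<11]. residue l j i) / real_of_int 18"
      by (simp add: box_point_def sum_divide_distrib interv_sum_list_conv_sum_set_nat atLeast0LessThan)
    then show "f (nat \<lfloor>sum (box_point (l, j)) {..<11}\<rfloor>) =
        f (nat ((\<Sum>i\<leftarrow>[0..<11]. residue l j i) div 18))"
      by (simp only: floor_divide_of_int_eq)
  qed
  \<comment> \<open>Distinctness turns the sum over a set into a sum over the list of heights, which
    can be evaluated.\<close>
  also have "\<dots> = (\<Sum>h\<leftarrow>map (\<lambda>(l, j). (\<Sum>i\<leftarrow>[0..<11]. residue l j i) div 18) box_index. f (nat h))"
    using distinct_box_index
    by (subst sum_list_distinct_conv_sum_set[symmetric]) (simp_all add: case_prod_unfold o_def)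
  also have "\<dots> = (\<Sum>k\<le>10. [1, 1, 1, 1, 9, 28, 9, 1, 1, 1, 1] ! k * f k)"
    unfolding heights_box_index by (simp add: eval_nat_numeral)
  finally show ?thesis .
qed

lemma card_lattice_points_vertex:
  "card ((\<lambda>x. real m *\<^sub>R x) ` (convex hull (vertex ` {..<11})) \<inter> lattice_points) =
    (\<Sum>k\<le>10. [1, 1, 1, 1, 9, 28, 9, 1, 1, 1, 1] ! k * ((m + 10 - k) choose 10))"
  using card_lattice_points_dilate[of "{..<11}" 10 vertex m]
    affine_independent_vertex vertex_in_lattice sum_box_vertex[of "\<lambda>k. (m + 10 - k) choose 10"]
  by (simp add: box_vertex)

text \<open>The variable is \<open>y = z * (z + 1)\<close>, and the factor
  \<open>201600 = 10! / 18\<close> clears denominators. The leading coefficient \<open>3\<close> is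
  \<open>54 * 201600 / 10!\<close>, where 54 is the number of box points.\<close>

definition ehrhart_quintic :: "complex poly" where
  "ehrhart_quintic = [:201600, 591600, 224228, 16784, 195, 3:]"

definition ehrhart_L :: "complex poly" where
  "ehrhart_L = smult (1 / 201600) (pcompose ehrhart_quintic [:0, 1, 1:])"

lemma poly_ehrhart_L: "poly ehrhart_L z = poly ehrhart_quintic (z * (z + 1)) / 201600"
  by (simp add: ehrhart_L_def poly_pcompose algebra_simps)

lemma degree_ehrhart_L: "degree ehrhart_L = 10"
  by (simp add: ehrhart_L_def ehrhart_quintic_def degree_pcompose)

lemma poly_ehrhart_L_of_nat:
  "poly ehrhart_L (of_nat m) =
    (\<Sum>k\<le>10. of_int ([1, 1, 1, 1, 9, 28, 9, 1, 1, 1, 1] ! k) * of_nat ((m + 10 - k) choose 10))"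
proof -
  define x where "x = (of_nat m :: complex)"
  \<comment> \<open>For \<open>k \<le> 10\<close> the subtraction is not truncated, so the binomial
    is a polynomial in \<open>x\<close> for every \<open>m\<close>.\<close>
  have bin: "of_nat ((m + 10 - k) choose 10) = (\<Prod>i<10. x + 10 - of_nat k - of_nat i) / 3628800"
    if "k \<le> 10" for k
    using that
    by (simp add: binomial_gbinomial gbinomial_prod_rev of_nat_diff x_def fact_numeral atLeast0LessThan)
  have "(\<Sum>k\<le>10. of_int ([1, 1, 1, 1, 9, 28, 9, 1, 1, 1, 1] ! k) * of_nat ((m + 10 - k) choose 10)) =
    (\<Sum>k\<le>10. of_int ([1, 1, 1, 1, 9, 28, 9, 1, 1, 1, 1] ! k) * (\<Prod>i<10. x + 10 - of_nat k - of_nat i)) / 3628800"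
    unfolding sum_divide_distrib by (intro sum.cong) (simp_all add: bin)
  \<comment> \<open>This is an identity of polynomials in \<open>x\<close>; the factor is
    \<open>18 = 10! / 201600\<close>.\<close>
  also have "(\<Sum>k\<le>10. of_int ([1, 1, 1, 1, 9, 28, 9, 1, 1, 1, 1] ! k) * (\<Prod>i<10. x + 10 - of_nat k - of_nat i)) =
    18 * poly ehrhart_quintic (x * (x + 1))"
    unfolding ehrhart_quintic_def by (simp add: eval_nat_numeral) algebra
  finally show ?thesis by (simp add: poly_ehrhart_L x_def)
qed

lemma is_ehrhart_polynomial_ehrhart_L: "is_ehrhart_polynomial (convex hull (vertex ` {..<11})) ehrhart_L"
  by (auto simp: is_ehrhart_polynomial_def degree_ehrhart_L card_lattice_points_vertex poly_ehrhart_L_of_nat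
      atMost_nat_numeral intro!: sum.cong)

lemma is_delta_vector_vertex:
  "is_delta_vector (convex hull (vertex ` {..<11})) [1, 1, 1, 1, 9, 28, 9, 1, 1, 1, 1]"
proof -
  have card: "CARD(10) = 10" by simp
  show ?thesis
    unfolding is_delta_vector_def ehrhart_polynomial_eqI[OF is_ehrhart_polynomial_ehrhart_L] card poly_ehrhart_L_of_nat
    by (intro conjI fps_binomial_generating_function) simp
qed

section \<open>A root outside the half-strip\<close>

lemma ehrhart_quintic_root:
  obtains y where "poly ehrhart_quintic y = 0" "\<bar>Re y + 24926159 / 1000000\<bar> < 3 / 2" "\<bar>Im y - 64631696 / 1000000\<bar> < 3 / 2"
proof -
  \<comment> \<open>A rational approximation of a nonreal root; the quintic is evaluated there
    exactly, by Horner's scheme.\<close>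
  define z where "z = Complex (- 24926159 / 1000000) (64631696 / 1000000)"
  have horner:
    "195 + z * 3 =
       Complex (120221523 / 1000000) (12118443 / 62500)"
    "16784 + z * Complex (120221523 / 1000000) (12118443 / 62500) =
       Complex (251114163794119 / 200000000000) (91783160449563 / 31250000000)"
    "224228 + z * Complex (251114163794119 / 200000000000) (91783160449563 / 31250000000) =
       Complex (3104199759526599942259 / 1000000000000000000) (496251165609520424161 / 62500000000000000)"
    "591600 + z * Complex (3104199759526599942259 / 1000000000000000000) (496251165609520424161 / 62500000000000000) =
       Complex (1047351621155344947224433923 / 1000000000000000000000000) (8486024544701572748589999 / 3125000000000000000000)"
    "201600 + z * Complex (1047351621155344947224433923 / 1000000000000000000000000) (8486024544701572748589999 / 3125000000000000000000) =
       Complex (-15623796766839249163886732349037 / 1000000000000000000000000000000) (277032393533765130676750037143 / 62500000000000000000000000000)"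
    by (simp_all add: z_def complex_eq_iff)
  have eq: "poly ehrhart_quintic z = Complex (-15623796766839249163886732349037 / 1000000000000000000000000000000) (277032393533765130676750037143 / 62500000000000000000000000000)"
    by (simp only: ehrhart_quintic_def poly_pCons poly_0 mult_zero_right add_0_right horner)
  \<comment> \<open>The norm is about 16.2, while \<open>3 * (3 / 2) ^ 5\<close> is about
    22.8.\<close>
  have "norm (poly ehrhart_quintic z) < 20"
    unfolding eq complex_norm by (rule real_less_lsqrt) (simp_all add: power2_eq_square)
  then have "norm (poly ehrhart_quintic z) < norm (lead_coeff ehrhart_quintic) * (3 / 2) ^ degree ehrhart_quintic"
    by (simp add: ehrhart_quintic_def power_divide)
  then obtain y where y: "poly ehrhart_quintic y = 0" "norm (y - z) < 3 / 2"
    using exists_root_near[of ehrhart_quintic "3 / 2" z] by (auto simp: ehrhart_quintic_def)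
  then show ?thesis
    using abs_Re_le_cmod[of "y - z"] abs_Im_le_cmod[of "y - z"]
    by (intro that[of y]) (auto simp: z_def)
qed

lemma ehrhart_L_root:
  obtains z where "poly ehrhart_L z = 0" "Re z > 4"
proof -
  obtain y where y: "poly ehrhart_quintic y = 0" "\<bar>Re y + 24926159 / 1000000\<bar> < 3 / 2" "\<bar>Im y - 64631696 / 1000000\<bar> < 3 / 2"
    by (rule ehrhart_quintic_root)
  \<comment> \<open>With \<open>w * w = 1 + 4 * y\<close>, the number \<open>(w - 1) / 2\<close>
    solves \<open>z * (z + 1) = y\<close>, and its real part exceeds \<open>4\<close> exactly when
    \<open>Re w > 9\<close>. The principal branch has \<open>Re w \<ge> 0\<close>.\<close>
  define w where "w = csqrt (1 + 4 * y)"
  have w2: "w * w = 1 + 4 * y"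
    using power2_csqrt[of "1 + 4 * y"] by (simp add: w_def power2_eq_square)
  have re: "Re w * Re w - Im w * Im w = 1 + 4 * Re y" and im: "Re w * Im w = 2 * Im y"
    using arg_cong[OF w2, of Re] arg_cong[OF w2, of Im] by (simp_all add: mult.commute)
  have "Re w > 9"
  proof (rule ccontr)
    assume "\<not> Re w > 9"
    moreover have "Re w \<ge> 0" using csqrt_principal[of "1 + 4 * y"] by (auto simp: w_def)
    ultimately have R: "Re w * Re w \<le> 81"
      using mult_mono[of "Re w" 9 "Re w" 9] by simp
    \<comment> \<open>Here \<open>Re y > -26.43\<close> bounds
      \<open>(Re w)^2 - 1 - 4 * Re y\<close>. The contradiction is that
      \<open>81 * 186 = 15066\<close> is less than \<open>126 * 126 = 15876\<close>.\<close>
    then have I: "Im w * Im w \<le> 186" using re y(2) by linarith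
    have "(Re w * Re w) * (Im w * Im w) \<le> 81 * 186"
      using R I by (intro mult_mono) auto
    moreover have "(Re w * Re w) * (Im w * Im w) = (2 * Im y) * (2 * Im y)"
      unfolding im[symmetric] by (simp add: algebra_simps)
    moreover have "126 * 126 \<le> (2 * Im y) * (2 * Im y)"
    proof -
      have "126 \<le> 2 * Im y" using y(3) unfolding abs_less_iff by linarith
      then show ?thesis by (intro mult_mono) auto
    qed
    ultimately show False by simp
  qed
  moreover have "(w - 1) / 2 * ((w - 1) / 2 + 1) = y"
    using w2 by (simp add: field_simps)
  ultimately show ?thesis
    using y(1) by (intro that[of "(w - 1) / 2"]) (simp_all add: poly_ehrhart_L)
qed

theorem mainTheorem5:
  shows "(\<exists>Q :: (real^10) set. reflexive_polytope Q \<and> \<not> half_strip_condition Q) \<and>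
    (let P = convex hull
           {axis 1 1, axis 2 1, axis 3 1, axis 4 1, axis 5 1, axis 6 1, axis 7 1, axis 8 1, axis 9 1,
            vector [1, 2, 0, 1, 2, 0, 1, 1, 2, 3],
            vector [-4, -5, -2, -3, -4, -1, -2, -2, -3, -3]} :: (real^10) set;
         L = ehrhart_polynomial P
     in 10 simplex P \<and>
        reflexive_polytope P \<and>
        is_ehrhart_polynomial P L \<and>
        is_delta_vector P [1, 1, 1, 1, 9, 28, 9, 1, 1, 1, 1] \<and>
        \<not> half_strip_condition P \<and>
        (\<exists>\<alpha>. poly L \<alpha> = 0 \<and> Re \<alpha> < -5) \<and>
        (\<exists>\<beta>. poly L \<beta> = 0 \<and> Re \<beta> > 4))"
proof -
  let ?P = "convex hull (vertex ` {..<11})"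
  note eq = ehrhart_polynomial_eqI[OF is_ehrhart_polynomial_ehrhart_L]
  obtain \<beta> where \<beta>: "poly ehrhart_L \<beta> = 0" "Re \<beta> > 4" by (rule ehrhart_L_root)
  \<comment> \<open>Since \<open>z * (z + 1)\<close> is invariant under \<open>z\<close> to
    \<open>- 1 - z\<close>, the reflected root has real part below \<open>-5\<close>.\<close>
  have \<alpha>: "poly ehrhart_L (- 1 - \<beta>) = 0"
    using \<beta>(1) by (simp add: poly_ehrhart_L algebra_simps)
  have strip: "\<not> half_strip_condition ?P"
    using \<beta> unfolding half_strip_condition_def eq by force
  have simplex: "10 simplex ?P"
    using simplex_convex_hull_family[OF _ affine_independent_vertex] by simp
  show ?thesis
    unfolding Let_def vertex_image[symmetric] eq
    using strip simplex reflexive_polytope_vertex is_ehrhart_polynomial_ehrhart_L is_delta_vector_vertex \<alpha> \<beta>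
    by (intro conjI exI[of _ ?P] exI[of _ "- 1 - \<beta>"] exI[of _ \<beta>]) auto
qed

end
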